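(* A topological space is $T_1$ if and only if it is $CT_1$.
   Context: Topological spaces are non-empty. For a space $X$, $\mathrm{Cld}(X)$ denotes the set of all non-empty closed subsets of $X$, endowed with the Vietoris topology, i.e. the topology having as a subbase all sets $U^-=\{F\in\mathrm{Cld}(X): F\cap U\neq\emptyset\}$ and $U^+=\{F\in\mathrm{Cld}(X): F\subseteq U\}$ with $U$ open in $X$. $X$ is called $CT_1$ if there is a continuous map $\phi=(\phi_1,\phi_2):X^2\setminus\{(x,x):x\in X\}\to\mathrm{Cld}(X)^2$ (subspace topology of the product $X^2$ on the domain, product topology on the codomain) such that for all $x_1\neq x_2$ in $X$: $x_1\notin\phi_1(x_1,x_2)$, $x_2\notin\phi_2(x_1,x_2)$, $x_1\in\phi_2(x_1,x_2)$ and $x_2\in\phi_1(x_1,x_2)$. *)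

theory Defs
  imports "HOL-Analysis.Analysis"
begin

definition Cld :: "'a topology \<Rightarrow> 'a set set" where
  "Cld X = {F. closedin X F \<and> F \<noteq> {}}"

definition vietoris_minus :: "'a topology \<Rightarrow> 'a set \<Rightarrow> 'a set set" where
  "vietoris_minus X U = {F \<in> Cld X. F \<inter> U \<noteq> {}}"

definition vietoris_plus :: "'a topology \<Rightarrow> 'a set \<Rightarrow> 'a set set" where
  "vietoris_plus X U = {F \<in> Cld X. F \<subseteq> U}"

(* The carrier of a generated topology is the union of the generating sets; here it is
   Cld X, since vietoris_plus X (topspace X) = Cld X belongs to the subbase. *)
definition vietoris :: "'a topology \<Rightarrow> 'a set topology" where
  "vietoris X = topology_generated_by
     ({vietoris_minus X U | U. openin X U} \<union> {vietoris_plus X U | U. openin X U})"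

lemma topspace_vietoris: "topspace (vietoris X) = Cld X"
proof -
  have "Cld X = vietoris_plus X (topspace X)"
    by (auto simp: vietoris_plus_def Cld_def dest: closedin_subset)
  then have "Cld X \<in> {vietoris_plus X U | U. openin X U}"
    by blast
  moreover have "vietoris_minus X U \<subseteq> Cld X" "vietoris_plus X U \<subseteq> Cld X" for U
    by (simp_all add: vietoris_minus_def vietoris_plus_def)
  ultimately show ?thesis
    unfolding vietoris_def topology_generated_by_topspace
    by (intro equalityI Union_upper Union_least) auto
qed

definition off_diagonal :: "'a topology \<Rightarrow> ('a \<times> 'a) topology" where
  "off_diagonal X = subtopology (prod_topology X X)
     (topspace (prod_topology X X) - {(x, x) | x. x \<in> topspace X})"

definition CT1_space :: "'a topology \<Rightarrow> bool" where
  "CT1_space X \<longleftrightarrow>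
     (\<exists>\<phi>. continuous_map (off_diagonal X) (prod_topology (vietoris X) (vietoris X)) \<phi> \<and>
       (\<forall>x\<^sub>1 \<in> topspace X. \<forall>x\<^sub>2 \<in> topspace X. x\<^sub>1 \<noteq> x\<^sub>2 \<longrightarrow>
          x\<^sub>1 \<notin> fst (\<phi> (x\<^sub>1, x\<^sub>2)) \<and> x\<^sub>2 \<notin> snd (\<phi> (x\<^sub>1, x\<^sub>2)) \<and>
          x\<^sub>1 \<in> snd (\<phi> (x\<^sub>1, x\<^sub>2)) \<and> x\<^sub>2 \<in> fst (\<phi> (x\<^sub>1, x\<^sub>2))))"

end

theory Submission
  imports Defs
begin

text \<open>
  In a \<open>T\<^sub>1\<close> space singletons are closed, and \<open>x \<mapsto> {x}\<close> is continuous into the Vietoris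
  hyperspace, because the preimages of both \<open>U\<^sup>-\<close> and \<open>U\<^sup>+\<close> under it are \<open>U\<close>; hence
  \<open>\<phi>(x, y) = ({y}, {x})\<close> is a \<open>CT\<^sub>1\<close> map. Conversely, for a \<open>CT\<^sub>1\<close> map \<open>\<phi>\<close> and \<open>x \<noteq> y\<close>,
  the complement of the closed set \<open>\<phi>\<^sub>1(x, y)\<close> is an open neighbourhood of \<open>x\<close> missing \<open>y\<close>.
\<close>

lemma continuous_map_singleton_vietoris:
  assumes "t1_space X"
  shows "continuous_map X (vietoris X) (\<lambda>x. {x})"
proof -
  have Cld: "{x} \<in> Cld X" if "x \<in> topspace X" for x
    using assms that by (simp add: Cld_def closedin_t1_singleton)
  show ?thesis
    unfolding vietoris_def
  proof (rule continuous_on_generated_topo)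
    fix V
    assume "V \<in> {vietoris_minus X U |U. openin X U} \<union> {vietoris_plus X U |U. openin X U}"
    then obtain U where U: "openin X U" and V: "V = vietoris_minus X U \<or> V = vietoris_plus X U"
      by blast
    have "(\<lambda>x. {x}) -` V \<inter> topspace X = U"
      using V Cld openin_subset[OF U] by (auto simp: vietoris_minus_def vietoris_plus_def)
    with U show "openin X ((\<lambda>x. {x}) -` V \<inter> topspace X)"
      by simp
  next
    show "(\<lambda>x. {x}) ` topspace X
      \<subseteq> \<Union> ({vietoris_minus X U |U. openin X U} \<union> {vietoris_plus X U |U. openin X U})"
      using Cld topspace_vietoris[of X]
      by (auto simp only: vietoris_def topology_generated_by_topspace)
  qed
qed

lemma t1_imp_CT1_space:
  assumes "t1_space X"
  shows "CT1_space X"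
proof -
  let ?\<phi> = "\<lambda>p. ({snd p}, {fst p})"
  have "continuous_map (prod_topology X X) (prod_topology (vietoris X) (vietoris X)) ?\<phi>"
    by (intro continuous_map_pairedI
        continuous_map_compose[OF continuous_map_fst
          continuous_map_singleton_vietoris[OF assms], unfolded o_def]
        continuous_map_compose[OF continuous_map_snd
          continuous_map_singleton_vietoris[OF assms], unfolded o_def])
  then have "continuous_map (off_diagonal X) (prod_topology (vietoris X) (vietoris X)) ?\<phi>"
    unfolding off_diagonal_def by (rule continuous_map_from_subtopology)
  then show ?thesis
    unfolding CT1_space_def by (intro exI[of _ ?\<phi>]) auto
qed

lemma CT1_imp_t1_space:
  assumes "CT1_space X"
  shows "t1_space X"
proof -
  obtain \<phi> where cont: "continuous_map (off_diagonal X) (prod_topology (vietoris X) (vietoris X)) \<phi>"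
    and sep: "\<And>x y. \<lbrakk>x \<in> topspace X; y \<in> topspace X; x \<noteq> y\<rbrakk>
      \<Longrightarrow> x \<notin> fst (\<phi> (x, y)) \<and> y \<in> fst (\<phi> (x, y))"
    using assms unfolding CT1_space_def by blast
  show ?thesis
    unfolding t1_space_def
  proof (intro ballI impI)
    fix x y
    assume xy: "x \<in> topspace X" "y \<in> topspace X" "x \<noteq> y"
    then have "(x, y) \<in> topspace (off_diagonal X)"
      by (auto simp: off_diagonal_def)
    then have "\<phi> (x, y) \<in> Cld X \<times> Cld X"
      using continuous_map_image_subset_topspace[OF cont] by (auto simp: topspace_vietoris)
    then have "closedin X (fst (\<phi> (x, y)))"
      by (auto simp: Cld_def)
    then have "openin X (topspace X - fst (\<phi> (x, y)))"
      by blast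
    with sep[OF xy] xy show "\<exists>U. openin X U \<and> x \<in> U \<and> y \<notin> U"
      by blast
  qed
qed

theorem theorem2p1:
  fixes X :: "'a topology"
  assumes "topspace X \<noteq> {}"
  shows "t1_space X \<longleftrightarrow> CT1_space X"
  using t1_imp_CT1_space CT1_imp_t1_space by blast

end
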